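(* Let $\diamond$ and $\diamondsuit$ be the operations of two dual semilattices, both with unit and both on the collection $\mathcal L$, and define an order on $\mathcal L$ by $x\le y$ if and only if $x\diamond y=y$. Then the order is a lattice with $x\vee y=x\diamond y$ and $x\wedge y=x\diamondsuit y$. Additionally, the units are the maximum and minimum of the order. Conversely, if $\mathcal L$ is a bounded lattice, then one has two dual semilattices whose operations are supremum and infimum, and the maximum and minimum are units.
   Context: A semilattice is a collection with a commutative, associative (everywhere defined) binary operation $\diamond$ such that every object is a primitive unit, i.e. $x\diamond x=x$ for all $x$. It has a unit if there is $e$ with $e\diamond x=x$ for all $x$. Two semilattices on the same collection with operations $\diamond,\diamondsuit$ are dual if for all $a,x$: $(x\diamondsuit a)\diamond a=a$ and $(x\diamond a)\diamondsuit a=a$. A lattice is a partial order in which every pair $x,y$ has a supremum $x\vee y$ and an infimum $x\wedge y$; it is bounded if it has a maximum and a minimum. *)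

theory Defs
  imports "HOL-Algebra.Lattice"
begin

text \<open>
  Semilattices on an arbitrary carrier set, to match the carrier-based lattices of HOL-Algebra
  (the locale \<open>semilattice\<close> of Main is confined to operations on a whole type).
\<close>

locale semilattice_on =
  fixes A :: "'a set" and f :: "'a \<Rightarrow> 'a \<Rightarrow> 'a"
  assumes closed: "\<lbrakk>x \<in> A; y \<in> A\<rbrakk> \<Longrightarrow> f x y \<in> A"
    and commute: "\<lbrakk>x \<in> A; y \<in> A\<rbrakk> \<Longrightarrow> f x y = f y x"
    and assoc: "\<lbrakk>x \<in> A; y \<in> A; z \<in> A\<rbrakk> \<Longrightarrow> f (f x y) z = f x (f y z)"
    and idem: "x \<in> A \<Longrightarrow> f x x = x"

definition unit_on :: "'a set \<Rightarrow> ('a \<Rightarrow> 'a \<Rightarrow> 'a) \<Rightarrow> 'a \<Rightarrow> bool"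
  where "unit_on A f e \<longleftrightarrow> e \<in> A \<and> (\<forall>x\<in>A. f e x = x)"

definition dual_on :: "'a set \<Rightarrow> ('a \<Rightarrow> 'a \<Rightarrow> 'a) \<Rightarrow> ('a \<Rightarrow> 'a \<Rightarrow> 'a) \<Rightarrow> bool"
  where "dual_on A f g \<longleftrightarrow> (\<forall>a\<in>A. \<forall>x\<in>A. f (g x a) a = a \<and> g (f x a) a = a)"

definition induced_gorder :: "'a set \<Rightarrow> ('a \<Rightarrow> 'a \<Rightarrow> 'a) \<Rightarrow> 'a gorder"
  where "induced_gorder A f = \<lparr>carrier = A, eq = (=), le = (\<lambda>x y. f x y = y)\<rparr>"

end

theory Submission
  imports Defs
begin

text \<open>
  In a semilattice \<open>f x y\<close> is the least upper bound of \<open>x\<close> and \<open>y\<close> for the order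
  \<open>f x y = y\<close>; this is where associativity, commutativity and idempotence enter.  Duality
  consists of the two absorption laws, which say exactly that \<open>f x y = y\<close> and \<open>g y x = x\<close>
  are equivalent: the order of \<open>g\<close> is the order of \<open>f\<close> turned upside down
  (lemma \<open>dual_on_le_swap\<close>).  Hence statements about infima and greatest elements are the
  statements about suprema and least elements, read for \<open>g\<close>.

  Conversely, associativity of supremum and infimum is the general fact that an iterated supremum
  is the supremum of three elements; the absorption laws and the unit laws hold because
  \<open>x \<squnion> a = a\<close> whenever \<open>x\<close> lies below \<open>a\<close>.  The statements about infima are obtained by
  inverting the order.
\<close>

lemma carrier_induced [simp]: "carrier (induced_gorder A f) = A"
  and eq_induced [simp]: "eq (induced_gorder A f) = (=)"
  and le_induced [simp]: "le (induced_gorder A f) x y \<longleftrightarrow> f x y = y"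
  by (simp_all add: induced_gorder_def)

context semilattice_on
begin

lemma partial_order_induced: "partial_order (induced_gorder A f)"
proof
  fix x y z
  assume xyz: "x \<in> carrier (induced_gorder A f)" "y \<in> carrier (induced_gorder A f)"
      "z \<in> carrier (induced_gorder A f)"
    and "x \<sqsubseteq>\<^bsub>induced_gorder A f\<^esub> y" "y \<sqsubseteq>\<^bsub>induced_gorder A f\<^esub> z"
  with assoc [of x y z] show "x \<sqsubseteq>\<^bsub>induced_gorder A f\<^esub> z"
    by simp
next
  fix x y
  assume "x \<sqsubseteq>\<^bsub>induced_gorder A f\<^esub> y" "y \<sqsubseteq>\<^bsub>induced_gorder A f\<^esub> x"
    "x \<in> carrier (induced_gorder A f)" "y \<in> carrier (induced_gorder A f)"
  then show "x .=\<^bsub>induced_gorder A f\<^esub> y"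
    using commute [of x y] by simp
qed (simp_all add: idem)

text \<open>
  That \<open>f x y\<close> is an upper bound is idempotence, after moving the repeated argument next to its
  copy; that it is the least one is associativity.
\<close>

lemma least_Upper_induced:
  assumes x: "x \<in> A" and y: "y \<in> A"
  shows "least (induced_gorder A f) (f x y) (Upper (induced_gorder A f) {x, y})"
proof (rule least_UpperI)
  have above_left: "f u (f u v) = f u v" if "u \<in> A" "v \<in> A" for u v
    using that assoc [of u u v] by (simp add: idem)
  fix u
  assume "u \<in> {x, y}"
  then show "u \<sqsubseteq>\<^bsub>induced_gorder A f\<^esub> f x y"
    using above_left [of x y] above_left [of y x] commute [of x y] x y by auto
next
  fix z
  assume "z \<in> Upper (induced_gorder A f) {x, y}"
  then have "z \<in> A" "f x z = z" "f y z = z"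
    using x y by (auto simp: Upper_def)
  then show "f x y \<sqsubseteq>\<^bsub>induced_gorder A f\<^esub> z"
    using assoc [of x y z] x y by simp
qed (use x y in \<open>simp_all add: closed\<close>)

end

text \<open>A unit is least because its defining equation \<open>f e x = x\<close> is literally the order relation.\<close>

lemma unit_on_iff_least: "unit_on A f e \<longleftrightarrow> least (induced_gorder A f) e A"
  by (auto simp: unit_on_def least_def)

text \<open>
  Each direction is one of the two absorption laws: if \<open>f x y = y\<close>, then \<open>g y x = g (f x y) x\<close>
  is absorbed to \<open>x\<close>.
\<close>

lemma dual_on_le_swap:
  assumes f: "semilattice_on A f" and g: "semilattice_on A g" and dual: "dual_on A f g"
    and x: "x \<in> A" and y: "y \<in> A"
  shows "f x y = y \<longleftrightarrow> g y x = x"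
proof
  assume "f x y = y"
  then have "f y x = y"
    using semilattice_on.commute [OF f x y] by simp
  moreover have "g (f y x) x = x"
    using dual x y by (simp add: dual_on_def)
  ultimately show "g y x = x" by simp
next
  assume "g y x = x"
  then have "g x y = x"
    using semilattice_on.commute [OF g x y] by simp
  moreover have "f (g x y) y = y"
    using dual x y by (simp add: dual_on_def)
  ultimately show "f x y = y" by simp
qed

text \<open>
  The two orders are converse to each other only on \<open>A\<close>, so the records need not be converse to
  each other as they stand; for subsets of \<open>A\<close> the notions of bound and extremum still
  correspond.
\<close>

lemma greatest_induced_dual:
  assumes "semilattice_on A f" "semilattice_on A g" "dual_on A f g" "S \<subseteq> A"
  shows "greatest (induced_gorder A f) z S \<longleftrightarrow> least (induced_gorder A g) z S"
  using assms(4) dual_on_le_swap [OF assms(1-3)]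
  unfolding greatest_def least_def by (simp, blast)

lemma Lower_induced_dual:
  assumes "semilattice_on A f" "semilattice_on A g" "dual_on A f g" "S \<subseteq> A"
  shows "Lower (induced_gorder A f) S = Upper (induced_gorder A g) S"
  using assms(4) dual_on_le_swap [OF assms(1-3)]
  unfolding Lower_def Upper_def by auto

lemma greatest_Lower_induced:
  assumes f: "semilattice_on A f" and g: "semilattice_on A g" and dual: "dual_on A f g"
    and x: "x \<in> A" and y: "y \<in> A"
  shows "greatest (induced_gorder A f) (g x y) (Lower (induced_gorder A f) {x, y})"
proof -
  have "Upper (induced_gorder A g) {x, y} \<subseteq> A"
    by (auto simp: Upper_def)
  then show ?thesis
    using semilattice_on.least_Upper_induced [OF g x y] x y
    by (simp add: Lower_induced_dual [OF f g dual] greatest_induced_dual [OF f g dual])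
qed

lemma lattice_induced:
  assumes f: "semilattice_on A f" and g: "semilattice_on A g" and dual: "dual_on A f g"
  shows "lattice (induced_gorder A f)"
proof -
  interpret partial_order "induced_gorder A f"
    by (rule semilattice_on.partial_order_induced [OF f])
  show ?thesis
    by unfold_locales
      (simp, blast intro: semilattice_on.least_Upper_induced [OF f]
        greatest_Lower_induced [OF f g dual])+
qed

text \<open>
  The operations \<open>\<squnion>\<close> and \<open>\<sqinter>\<close> choose some extremal bound; antisymmetry makes every extremal
  bound the chosen one.
\<close>

lemma (in lattice) join_eqI:
  assumes "x \<in> carrier L" "y \<in> carrier L" "least L s (Upper L {x, y})"
  shows "x \<squnion> y = s"
  using least_unique [OF sup_of_two_least assms(3)] assms(1,2) by (simp add: join_def)

lemma (in lattice) meet_eqI: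
  assumes "x \<in> carrier L" "y \<in> carrier L" "greatest L i (Lower L {x, y})"
  shows "x \<sqinter> y = i"
  using greatest_unique [OF inf_of_two_greatest assms(3)] assms(1,2) by (simp add: meet_def)

context lattice
begin

lemma semilattice_on_join: "semilattice_on (carrier L) (join L)"
proof
  fix x y z
  assume xyz: "x \<in> carrier L" "y \<in> carrier L" "z \<in> carrier L"
  show "x \<squnion> y \<squnion> z = x \<squnion> (y \<squnion> z)"
    using weak_join_assoc [OF xyz] by (simp add: eq_is_equal)
next
  fix x
  assume x: "x \<in> carrier L"
  then show "x \<squnion> x = x"
    using le_iff_meet [OF x x] by simp
qed (simp_all add: join_comm)

lemma join_meet_absorb:
  assumes x: "x \<in> carrier L" and a: "a \<in> carrier L"
  shows "(x \<sqinter> a) \<squnion> a = a"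
  using le_iff_meet [of "x \<sqinter> a" a] meet_right [OF x a] x a by simp

lemma unit_on_join:
  assumes "least L b (carrier L)"
  shows "unit_on (carrier L) (join L) b"
  using assms le_iff_meet unfolding unit_on_def least_def by blast

end

context lattice
begin

interpretation inv: lattice "inv_gorder L"
  by (rule dual_lattice)

lemma semilattice_on_meet: "semilattice_on (carrier L) (meet L)"
proof -
  have "join (inv_gorder L) = meet L"
    by (intro ext) simp
  then show ?thesis
    using inv.semilattice_on_join by simp
qed

lemma dual_on_join_meet: "dual_on (carrier L) (join L) (meet L)"
  using join_meet_absorb inv.join_meet_absorb by (simp add: dual_on_def)

lemma unit_on_meet:
  assumes "greatest L t (carrier L)"
  shows "unit_on (carrier L) (meet L) t"
  using assms inv.unit_on_join [of t] by (simp add: unit_on_def)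

end

theorem theorem15p4:
  shows
    "(\<forall>(A :: 'a set) f g e e'.
        semilattice_on A f \<and> semilattice_on A g \<and> dual_on A f g \<and>
        unit_on A f e \<and> unit_on A g e' \<longrightarrow>
          (let L = induced_gorder A f in
            lattice L \<and>
            (\<forall>x\<in>A. \<forall>y\<in>A. x \<squnion>\<^bsub>L\<^esub> y = f x y \<and> x \<sqinter>\<^bsub>L\<^esub> y = g x y) \<and>
            least L e A \<and> greatest L e' A)) \<and>
     (\<forall>L :: ('b, 'c) gorder_scheme.
        bounded_lattice L \<longrightarrow>
          semilattice_on (carrier L) (join L) \<and> semilattice_on (carrier L) (meet L) \<and>
          dual_on (carrier L) (join L) (meet L) \<and>
          (\<forall>b. least L b (carrier L) \<longrightarrow> unit_on (carrier L) (join L) b) \<and>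
          (\<forall>t. greatest L t (carrier L) \<longrightarrow> unit_on (carrier L) (meet L) t))"
proof (intro conjI allI impI)
  fix A :: "'a set" and f g e e'
  assume "semilattice_on A f \<and> semilattice_on A g \<and> dual_on A f g \<and>
    unit_on A f e \<and> unit_on A g e'"
  then have f: "semilattice_on A f" and g: "semilattice_on A g" and dual: "dual_on A f g"
    and e: "unit_on A f e" and e': "unit_on A g e'"
    by auto
  interpret L: lattice "induced_gorder A f"
    by (rule lattice_induced [OF f g dual])
  have "x \<squnion>\<^bsub>induced_gorder A f\<^esub> y = f x y \<and> x \<sqinter>\<^bsub>induced_gorder A f\<^esub> y = g x y"
    if "x \<in> A" "y \<in> A" for x y
    using that L.join_eqI [OF _ _ semilattice_on.least_Upper_induced [OF f that]]
      L.meet_eqI [OF _ _ greatest_Lower_induced [OF f g dual that]]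
    by simp
  moreover have "least (induced_gorder A f) e A"
    using e by (simp add: unit_on_iff_least)
  moreover have "greatest (induced_gorder A f) e' A"
    using e' by (simp add: unit_on_iff_least greatest_induced_dual [OF f g dual])
  ultimately show "let L = induced_gorder A f in
      lattice L \<and>
      (\<forall>x\<in>A. \<forall>y\<in>A. x \<squnion>\<^bsub>L\<^esub> y = f x y \<and> x \<sqinter>\<^bsub>L\<^esub> y = g x y) \<and>
      least L e A \<and> greatest L e' A"
    using L.lattice_axioms by (simp add: Let_def)
next
  fix L :: "('b, 'c) gorder_scheme"
  assume "bounded_lattice L"
  then interpret bounded_lattice L .
  show "semilattice_on (carrier L) (join L)" "semilattice_on (carrier L) (meet L)"
    "dual_on (carrier L) (join L) (meet L)"
    by (rule semilattice_on_join semilattice_on_meet dual_on_join_meet)+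
  show "unit_on (carrier L) (join L) b" if "least L b (carrier L)" for b
    using that by (rule unit_on_join)
  show "unit_on (carrier L) (meet L) t" if "greatest L t (carrier L)" for t
    using that by (rule unit_on_meet)
qed

end
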